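(* Let $I=(S,T,C,\alpha)$ be a feasible instance of FLaMECaST with $\alpha=1$. Then there is a valid layout of minimum cost for $I$ in which every source is directly connected to a sink (i.e., the layout has no Steiner vertices).
   Context: FLaMECaST: an instance $I=(S,T,C,\alpha)$ consists of a finite set $S$ of sources and a finite set $T$ of sinks, each with a fixed position in $\mathbb{R}^2$ (several sources may share a position), capacities $C=(c_0,\dots,c_{\lambda+1})$ with integers $c_0\ge c_1\ge\dots\ge c_{\lambda+1}\ge 1$ ($\lambda\ge 0$ is the number of intermediate layers), and a parameter $\alpha\in[0,1]$. A topology is a rooted forest (edges directed from child to parent) of height at most $\lambda+1$ whose leaves are exactly $S$ and whose roots form a subset of $T$; its other vertices are Steiner vertices. The layer of a vertex is the number of edges on its path to its root. The load $\ell(v)$ of a vertex is the number of sources in its subtree; the load of an edge $uv$ ($u$ child of $v$) is $\ell(u)$. A topology is valid if $\ell(v)\le c_i$ for every vertex $v$ in layer $i$. An embedding maps each vertex to a point of $\mathbb{R}^2$, sources and sinks to their given positions and Steiner vertices arbitrarily; a topology with an embedding is a layout (valid if its topology is valid). The cost of an edge $uv$ is $\|\mathrm{pos}(u)-\mathrm{pos}(v)\|\cdot\ell(uv)^\alpha$ and the cost of a layout is the sum of its edge costs. The instance is feasible if it has a valid layout. *)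

theory Defs
  imports "HOL-Analysis.Analysis"
begin

text \<open>
  The list \<open>capacities\<close> is \<open>[c\<^sub>0, \<dots>, c\<^bsub>\<lambda>+1\<^esub>]\<close>, so \<open>\<lambda>\<close> is its length minus two.
\<close>

record ('s, 't) flamecast =
  sources :: "'s set"
  sinks :: "'t set"
  source_pos :: "'s \<Rightarrow> real ^ 2"
  sink_pos :: "'t \<Rightarrow> real ^ 2"
  capacities :: "nat list"
  alpha :: real

definition num_intermediate_layers :: "('s, 't) flamecast \<Rightarrow> nat" where
  "num_intermediate_layers I = length (capacities I) - 2"

definition is_instance :: "('s, 't) flamecast \<Rightarrow> bool" where
  "is_instance I \<longleftrightarrow>
     finite (sources I) \<and> finite (sinks I) \<and>
     length (capacities I) \<ge> 2 \<and> sorted_wrt (\<ge>) (capacities I) \<and>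
     (\<forall>c\<in>set (capacities I). c \<ge> 1) \<and>
     0 \<le> alpha I \<and> alpha I \<le> 1"

text \<open>
  Topologies are finite, so countably many names for Steiner vertices suffice.
\<close>

datatype ('s, 't) vertex = Source 's | Sink 't | Steiner nat

record ('s, 't) layout =
  verts :: "('s, 't) vertex set"
  edges :: "(('s, 't) vertex \<times> ('s, 't) vertex) set"
  pos :: "('s, 't) vertex \<Rightarrow> real ^ 2"

text \<open>
  A rooted forest is given by its child-to-parent edges: every vertex has at most one
  parent, and there are no directed cycles.
\<close>

definition rooted_forest :: "'v set \<Rightarrow> ('v \<times> 'v) set \<Rightarrow> bool" where
  "rooted_forest V E \<longleftrightarrow> finite V \<and> E \<subseteq> V \<times> V \<and> single_valued E \<and> acyclic E"

definition roots :: "'v set \<Rightarrow> ('v \<times> 'v) set \<Rightarrow> 'v set" where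
  "roots V E = {v \<in> V. \<nexists>p. (v, p) \<in> E}"

definition leaves :: "'v set \<Rightarrow> ('v \<times> 'v) set \<Rightarrow> 'v set" where
  "leaves V E = {v \<in> V. \<nexists>u. (u, v) \<in> E}"

definition layer :: "'v set \<Rightarrow> ('v \<times> 'v) set \<Rightarrow> 'v \<Rightarrow> nat" where
  "layer V E v = (THE n. \<exists>r\<in>roots V E. (v, r) \<in> E ^^ n)"

definition is_topology ::
  "('s, 't) flamecast \<Rightarrow> ('s, 't) vertex set \<Rightarrow> (('s, 't) vertex \<times> ('s, 't) vertex) set \<Rightarrow> bool"
where
  "is_topology I V E \<longleftrightarrow>
     rooted_forest V E \<and>
     (\<forall>v\<in>V. layer V E v \<le> num_intermediate_layers I + 1) \<and>
     leaves V E = Source ` sources I \<and>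
     roots V E \<subseteq> Sink ` sinks I \<and>
     V - (leaves V E \<union> roots V E) \<subseteq> range Steiner"

definition load ::
  "('s, 't) flamecast \<Rightarrow> (('s, 't) vertex \<times> ('s, 't) vertex) set \<Rightarrow> ('s, 't) vertex \<Rightarrow> nat"
where
  "load I E v = card {s \<in> sources I. (Source s, v) \<in> E\<^sup>*}"

definition valid_topology ::
  "('s, 't) flamecast \<Rightarrow> ('s, 't) vertex set \<Rightarrow> (('s, 't) vertex \<times> ('s, 't) vertex) set \<Rightarrow> bool"
where
  "valid_topology I V E \<longleftrightarrow>
     is_topology I V E \<and> (\<forall>v\<in>V. load I E v \<le> capacities I ! layer V E v)"

definition is_embedding ::
  "('s, 't) flamecast \<Rightarrow> ('s, 't) vertex set \<Rightarrow> (('s, 't) vertex \<Rightarrow> real ^ 2) \<Rightarrow> bool"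
where
  "is_embedding I V p \<longleftrightarrow>
     (\<forall>s. Source s \<in> V \<longrightarrow> p (Source s) = source_pos I s) \<and>
     (\<forall>t. Sink t \<in> V \<longrightarrow> p (Sink t) = sink_pos I t)"

definition valid_layout :: "('s, 't) flamecast \<Rightarrow> ('s, 't) layout \<Rightarrow> bool" where
  "valid_layout I L \<longleftrightarrow>
     valid_topology I (verts L) (edges L) \<and> is_embedding I (verts L) (pos L)"

definition cost :: "('s, 't) flamecast \<Rightarrow> ('s, 't) layout \<Rightarrow> real" where
  "cost I L =
     (\<Sum>(u, v)\<in>edges L. norm (pos L u - pos L v) * real (load I (edges L) u) powr alpha I)"

definition feasible :: "('s, 't) flamecast \<Rightarrow> bool" where
  "feasible I \<longleftrightarrow> (\<exists>L. valid_layout I L)"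

definition min_cost_layout :: "('s, 't) flamecast \<Rightarrow> ('s, 't) layout \<Rightarrow> bool" where
  "min_cost_layout I L \<longleftrightarrow>
     valid_layout I L \<and> (\<forall>L'. valid_layout I L' \<longrightarrow> cost I L \<le> cost I L')"

end

theory Submission
  imports Defs
begin

text \<open>
  For \<open>\<alpha> = 1\<close> an edge of load \<open>k\<close> costs as much as \<open>k\<close> separate unit-load edges, so the cost of
  a layout is the sum over all sources of the length of the path from the source to its root. By the
  triangle inequality each path may be replaced by a straight edge to that root. The root loads
  do not change, and a source in layer 1 has load 1, so validity is preserved. Hence every valid
  layout is dominated by a direct one, and there are only finitely many direct assignments of
  sources to sinks.
\<close>

text \<open>Each vertex has at most one parent, so the walk upwards is forced, and it cannot
  continue past a root. This makes the \<open>THE\<close> in \<open>layer\<close> denote a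
  value.\<close>

lemma relpow_to_root_unique:
  assumes "single_valued E" "r \<in> roots V E" "r' \<in> roots V E"
    and "(v, r) \<in> E ^^ n" "(v, r') \<in> E ^^ m"
  shows "n = m"
  using assms(4,5)
proof (induction n arbitrary: v m)
  case 0
  then have "v = r" by simp
  then show ?case
    using 0 assms(2)
    by (cases m) (auto simp: roots_def simp del: relpow.simps dest!: relpow_Suc_D2)
next
  case (Suc n)
  from Suc.prems(1) obtain w where w: "(v, w) \<in> E" "(w, r) \<in> E ^^ n"
    by (meson relpow_Suc_D2)
  show ?case
  proof (cases m)
    case 0
    then have "v = r'" using Suc.prems by simp
    with w assms(3) show ?thesis by (auto simp: roots_def)
  next
    case (Suc k)
    with Suc.prems(2) obtain w' where w': "(v, w') \<in> E" "(w', r') \<in> E ^^ k"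
      by (meson relpow_Suc_D2)
    have "w = w'" using w w' assms(1) by (auto dest: single_valuedD)
    then show ?thesis using Suc.IH[OF w(2)] w' Suc by simp
  qed
qed

lemma layer_eqI:
  assumes "single_valued E" "r \<in> roots V E" "(v, r) \<in> E ^^ n"
  shows "layer V E v = n"
  unfolding layer_def
  using assms by (intro the_equality) (auto dest: relpow_to_root_unique)

lemma exists_root:
  assumes "rooted_forest V E" "v \<in> V"
  shows "\<exists>r\<in>roots V E. (v, r) \<in> E\<^sup>*"
proof -
  have EV: "E \<subseteq> V \<times> V" and "finite E" "acyclic E"
    using assms(1) by (auto simp: rooted_forest_def intro: finite_subset)
  \<comment> \<open>Well-foundedness of the converse makes the parent the smaller element, so the
    induction hypothesis applies to the parent of \<open>v\<close>.\<close>
  then have "wf (E\<inverse>)" by (simp add: finite_acyclic_wf_converse)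
  then show ?thesis using assms(2)
  proof (induction v)
    case (less v)
    show ?case
    proof (cases "v \<in> roots V E")
      case False
      with less.prems obtain p where p: "(v, p) \<in> E" by (auto simp: roots_def)
      with EV less.IH[of p] show ?thesis by (auto intro: converse_rtrancl_into_rtrancl)
    qed auto
  qed
qed

text \<open>Triangle inequality along the path from \<open>a\<close> to \<open>b\<close>, bounded by
  all edges whose tail is reachable from \<open>a\<close>. Reachability of tails is also what
  \<open>load\<close> counts, which allows the later double counting.\<close>

lemma norm_diff_le_sum_reachable_edges:
  fixes p :: "'v \<Rightarrow> 'a::real_normed_vector"
  assumes "finite E" "acyclic E" "(a, b) \<in> E\<^sup>*"
  shows "norm (p a - p b) \<le> (\<Sum>(u, v) | (u, v) \<in> E \<and> (a, u) \<in> E\<^sup>*. norm (p u - p v))"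
  using assms(3)
proof (induction rule: converse_rtrancl_induct)
  case base
  show ?case by (auto intro: sum_nonneg)
next
  case (step a a')
  let ?F = "\<lambda>a. {(u, v). (u, v) \<in> E \<and> (a, u) \<in> E\<^sup>*}"
  have fin: "finite (?F x)" for x
    by (rule finite_subset[OF _ assms(1)]) auto
  \<comment> \<open>If \<open>a\<close> were reachable from \<open>a'\<close>, the edge would close
    a cycle; so the first edge is not counted twice.\<close>
  have new: "(a, a') \<notin> ?F a'"
    using step.hyps(1) assms(2) by (auto simp: acyclic_def intro: rtrancl_into_trancl2)
  have "norm (p a - p b) \<le> norm (p a - p a') + norm (p a' - p b)"
    using norm_triangle_ineq[of "p a - p a'" "p a' - p b"] by simp
  also have "\<dots> \<le> norm (p a - p a') + (\<Sum>(u, v)\<in>?F a'. norm (p u - p v))"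
    using step.IH by simp
  also have "\<dots> = (\<Sum>(u, v)\<in>insert (a, a') (?F a'). norm (p u - p v))"
    using new fin by simp
  also have "\<dots> \<le> (\<Sum>(u, v)\<in>?F a. norm (p u - p v))"
    using step.hyps(1) fin
    by (intro sum_mono2) (auto intro: converse_rtrancl_into_rtrancl)
  finally show ?case .
qed

definition direct_edges ::
  "('s, 't) flamecast \<Rightarrow> ('s \<Rightarrow> 't) \<Rightarrow> (('s, 't) vertex \<times> ('s, 't) vertex) set"
where
  "direct_edges I f = (\<lambda>s. (Source s, Sink (f s))) ` sources I"

text \<open>Only sinks in the image of \<open>f\<close> are vertices: any other sink would be
  isolated, hence a leaf that is not a source. The Steiner position \<open>0\<close> is a dummy
  value.\<close>

definition direct_layout :: "('s, 't) flamecast \<Rightarrow> ('s \<Rightarrow> 't) \<Rightarrow> ('s, 't) layout" where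
  "direct_layout I f =
     \<lparr>verts = Source ` sources I \<union> Sink ` f ` sources I,
      edges = direct_edges I f,
      pos = case_vertex (source_pos I) (sink_pos I) (\<lambda>_. 0)\<rparr>"

definition direct_cost :: "('s, 't) flamecast \<Rightarrow> ('s \<Rightarrow> 't) \<Rightarrow> real" where
  "direct_cost I f = (\<Sum>s\<in>sources I. norm (source_pos I s - sink_pos I (f s)))"

text \<open>Extensional functions keep this set finite. Only the root capacity appears, as sources
  have load 1 in a direct layout.\<close>

definition direct_assignments :: "('s, 't) flamecast \<Rightarrow> ('s \<Rightarrow> 't) set" where
  "direct_assignments I =
     {f \<in> sources I \<rightarrow>\<^sub>E sinks I. \<forall>t. card {s \<in> sources I. f s = t} \<le> capacities I ! 0}"

text \<open>Edges lead from sources to sinks, so no two of them can be composed.\<close>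

lemma direct_edges_trancl:
  assumes "(u, v) \<in> (direct_edges I f)\<^sup>+"
  shows "(u, v) \<in> direct_edges I f"
  using assms by induction (auto simp: direct_edges_def)

lemma load_direct_source:
  assumes "s \<in> sources I"
  shows "load I (direct_edges I f) (Source s) = 1"
proof -
  have "{s' \<in> sources I. (Source s', Source s) \<in> (direct_edges I f)\<^sup>*} = {s}"
    using assms by (auto simp: rtrancl_eq_or_trancl direct_edges_def
        dest!: direct_edges_trancl[unfolded direct_edges_def])
  then show ?thesis by (simp add: load_def)
qed

lemma load_direct_sink:
  "load I (direct_edges I f) (Sink t) = card {s \<in> sources I. f s = t}"
proof -
  have "{s \<in> sources I. (Source s, Sink t) \<in> (direct_edges I f)\<^sup>*} = {s \<in> sources I. f s = t}"
    by (auto simp: rtrancl_eq_or_trancl dest!: direct_edges_trancl)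
      (auto simp: direct_edges_def)
  then show ?thesis by (simp add: load_def)
qed

lemma valid_direct_layout:
  assumes "is_instance I" "f \<in> direct_assignments I"
  shows "valid_layout I (direct_layout I f)"
proof -
  define V where "V = verts (direct_layout I f)"
  define E where "E = direct_edges I f"
  have V: "V = Source ` sources I \<union> Sink ` f ` sources I"
    by (simp add: V_def direct_layout_def)
  have sv: "single_valued E"
    by (auto simp: E_def direct_edges_def single_valued_def)
  have "acyclic E"
    unfolding acyclic_def E_def
    by (auto dest!: direct_edges_trancl) (auto simp: direct_edges_def)
  with sv assms(1) have forest: "rooted_forest V E"
    by (auto simp: rooted_forest_def V E_def direct_edges_def is_instance_def)
  have leaves: "leaves V E = Source ` sources I"
    by (auto simp: leaves_def V E_def direct_edges_def)
  have roots: "roots V E = Sink ` f ` sources I"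
    by (auto simp: roots_def V E_def direct_edges_def)
  have layer_source: "layer V E (Source s) = 1" if "s \<in> sources I" for s
    using that sv roots by (intro layer_eqI[of _ "Sink (f s)"]) (auto simp: E_def direct_edges_def)
  have layer_sink: "layer V E (Sink (f s)) = 0" if "s \<in> sources I" for s
    using that sv roots by (intro layer_eqI[of _ "Sink (f s)"]) auto
  have "is_topology I V E"
    unfolding is_topology_def using forest leaves roots layer_source layer_sink assms(2)
    by (auto simp: V direct_assignments_def)
  \<comment> \<open>Sources lie in layer 1 with load 1, so this bound is their validity
    condition.\<close>
  moreover have "capacities I ! 1 \<ge> 1"
    using assms(1) by (simp add: is_instance_def)
  ultimately have "valid_topology I V E"
    using layer_source layer_sink assms(2)
    by (auto simp: valid_topology_def V E_def load_direct_source load_direct_sink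
        direct_assignments_def)
  then show ?thesis
    by (auto simp: valid_layout_def is_embedding_def V_def E_def direct_layout_def)
qed

lemma cost_direct_layout:
  "cost I (direct_layout I f) = direct_cost I f"
proof -
  have "cost I (direct_layout I f) =
      (\<Sum>s\<in>sources I. norm (source_pos I s - sink_pos I (f s)) *
        real (load I (direct_edges I f) (Source s)) powr alpha I)"
    unfolding cost_def direct_layout_def
    by (simp, subst direct_edges_def, subst sum.reindex) (auto simp: inj_on_def)
  also have "\<dots> = direct_cost I f"
    by (simp add: direct_cost_def load_direct_source)
  finally show ?thesis .
qed

lemma valid_layout_dominated_by_direct:
  assumes I: "is_instance I" "alpha I = 1" and L: "valid_layout I L"
  shows "\<exists>f\<in>direct_assignments I. direct_cost I f \<le> cost I L"
proof -
  define V E p S where "V = verts L" and "E = edges L" and "p = pos L" and "S = sources I"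
  have top: "is_topology I V E"
    and load_le: "\<And>v. v \<in> V \<Longrightarrow> load I E v \<le> capacities I ! layer V E v"
    and emb: "is_embedding I V p"
    using L by (auto simp: valid_layout_def valid_topology_def V_def E_def p_def)
  have forest: "rooted_forest V E" and roots: "roots V E \<subseteq> Sink ` sinks I"
    and leaves: "leaves V E = Source ` S"
    using top by (auto simp: is_topology_def S_def)
  have sv: "single_valued E" and ac: "acyclic E" and finE: "finite E"
    using forest by (auto simp: rooted_forest_def intro: finite_subset)
  have finS: "finite S" using I by (simp add: is_instance_def S_def)
  have SV: "Source s \<in> V" if "s \<in> S" for s
    using leaves that by (auto simp: leaves_def)
  \<comment> \<open>Each source is assigned to the root of its own tree in \<open>L\<close>.\<close>
  have "\<exists>t\<in>sinks I. Sink t \<in> roots V E \<and> (Source s, Sink t) \<in> E\<^sup>*" if "s \<in> S" for s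
    using exists_root[OF forest SV[OF that]] roots by blast
  then obtain g where g: "\<And>s. s \<in> S \<Longrightarrow>
      g s \<in> sinks I \<and> Sink (g s) \<in> roots V E \<and> (Source s, Sink (g s)) \<in> E\<^sup>*"
    by metis
  define f where "f = restrict g S"
  have card_le: "card {s \<in> S. f s = t} \<le> capacities I ! 0" for t
  proof (cases "\<exists>s\<in>S. f s = t")
    case True
    then have root: "Sink t \<in> roots V E" using g by (auto simp: f_def)
    \<comment> \<open>All sources assigned to \<open>t\<close> lie in the subtree of
      \<open>Sink t\<close>, so its load in \<open>L\<close> already covers them.\<close>
    have "card {s \<in> S. f s = t} \<le> load I E (Sink t)"
      unfolding load_def S_def[symmetric]
      using finS g by (intro card_mono) (auto simp: f_def)
    also have "\<dots> \<le> capacities I ! layer V E (Sink t)"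
      using load_le root by (simp add: roots_def)
    also have "layer V E (Sink t) = 0"
      using layer_eqI[OF sv root] by simp
    finally show ?thesis .
  next
    case False
    then have "{s \<in> S. f s = t} = {}" by auto
    then show ?thesis by (simp only: card.empty)
  qed
  have "f \<in> direct_assignments I"
    using card_le g by (auto simp: direct_assignments_def f_def S_def[symmetric])
  moreover have "direct_cost I f \<le> cost I L"
  proof -
    let ?d = "\<lambda>e. norm (p (fst e) - p (snd e))"
    have "direct_cost I f = (\<Sum>s\<in>S. norm (p (Source s) - p (Sink (g s))))"
      unfolding direct_cost_def S_def[symmetric]
    proof (rule sum.cong[OF refl])
      fix s assume s: "s \<in> S"
      then have "Sink (g s) \<in> V" using g by (auto simp: roots_def)
      with emb SV[OF s] s show "norm (source_pos I s - sink_pos I (f s)) =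
          norm (p (Source s) - p (Sink (g s)))"
        by (simp add: is_embedding_def f_def)
    qed
    also have "\<dots> \<le> (\<Sum>s\<in>S. \<Sum>e | e \<in> E \<and> (Source s, fst e) \<in> E\<^sup>*. ?d e)"
      using norm_diff_le_sum_reachable_edges[OF finE ac, of _ _ p] g
      by (intro sum_mono) (simp add: case_prod_beta')
    \<comment> \<open>Double counting: after the swap, \<open>?d e\<close> is summed once per source
      below the tail of \<open>e\<close>, that is, \<open>load\<close> many times. With \<alpha> = 1
      this is the cost of \<open>e\<close>.\<close>
    also have "\<dots> = (\<Sum>e\<in>E. \<Sum>s | s \<in> S \<and> (Source s, fst e) \<in> E\<^sup>*. ?d e)"
      using finS finE by (rule sum.swap_restrict)
    also have "\<dots> = cost I L"
      unfolding cost_def load_def E_def[symmetric] p_def[symmetric] S_def[symmetric]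
      by (simp add: I(2) case_prod_beta' mult.commute)
    finally show ?thesis .
  qed
  ultimately show ?thesis by blast
qed

theorem mainTheorem2:
  fixes I :: "('s, 't) flamecast"
  assumes "is_instance I"
    and "feasible I"
    and "alpha I = 1"
  shows "\<exists>L :: ('s, 't) layout. min_cost_layout I L \<and>
           (\<forall>s\<in>sources I. \<exists>t\<in>sinks I. (Source s, Sink t) \<in> edges L) \<and>
           verts L \<inter> range Steiner = {}"
proof -
  let ?A = "direct_assignments I"
  have "finite (sources I \<rightarrow>\<^sub>E sinks I)"
    using assms(1) by (auto simp: is_instance_def intro: finite_PiE)
  then have "finite ?A" by (simp add: direct_assignments_def)
  \<comment> \<open>Feasibility enters here: the layout it provides is dominated by some direct
    assignment.\<close>
  moreover have "?A \<noteq> {}"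
    using assms valid_layout_dominated_by_direct by (fastforce simp: feasible_def)
  ultimately obtain f where f: "f \<in> ?A" "\<And>g. g \<in> ?A \<Longrightarrow> direct_cost I f \<le> direct_cost I g"
    using ex_min_if_finite[of "direct_cost I ` ?A"] by (force simp: not_less)
  have "min_cost_layout I (direct_layout I f)"
    unfolding min_cost_layout_def cost_direct_layout
    using valid_direct_layout[OF assms(1) f(1)] f(2)
      valid_layout_dominated_by_direct[OF assms(1,3)]
    by (meson order_trans)
  moreover have "\<forall>s\<in>sources I. \<exists>t\<in>sinks I. (Source s, Sink t) \<in> edges (direct_layout I f)"
    using f(1) by (auto simp: direct_layout_def direct_edges_def direct_assignments_def)
  moreover have "verts (direct_layout I f) \<inter> range Steiner = {}"
    by (auto simp: direct_layout_def)
  ultimately show ?thesis by blast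
qed

end
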